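(* Let $n\ge1$, $G=K_{40n+1,40n+3}$ (the complete bipartite graph with parts of sizes $40n+1$ and $40n+3$). Every Hitting$(\oplus)$ refutation of the CNF $\mathrm{PM}_G$ contains $2^{\Omega(n)}$ $\oplus$-clauses (affine subspaces).
   Context: $\mathrm{PM}_G$ has a variable $z_e$ for every edge $e\in E(G)$ and, for every vertex $v$, the clauses $\bar z_f\vee\bar z_g$ for every pair of distinct edges $f,g$ incident to $v$ and the clause $\bigvee_{e\ni v}z_e$. A $\oplus$-clause is a disjunction of affine equations over $\mathrm{GF}(2)$ of the form $\bigoplus_{i\in I}x_i=c$ (a literal $x$ is the equation $x=1$, and $\bar x$ is $x=0$); the set of assignments falsifying it is an affine subspace. A hitting$(\oplus)$ formula is a conjunction of $\oplus$-clauses such that no two of them have a common falsifying assignment. A Hitting$(\oplus)$ refutation of a CNF $F$ is an unsatisfiable hitting$(\oplus)$ formula $H$ such that every $\oplus$-clause $C$ of $H$ has a clause $C'\subseteq C$ of $F$ (viewing literals as equations); its size is the number of $\oplus$-clauses in $H$. *)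

theory Defs
  imports Complex_Main "HOL-Library.Z2"
begin

text \<open>Assignments are functions into \<^typ>\<open>bit\<close> = GF(2), with 1 for true and 0 for false.\<close>

datatype 'v literal = Pos 'v | Neg 'v

type_synonym 'v cnf = "'v literal set set"

text \<open>The pair \<open>(I, c)\<close> stands for the affine equation \<open>(\<Sum>i\<in>I. x i) = c\<close> over GF(2);
  a parity clause is the set of its disjuncts.\<close>

type_synonym 'v equation = "'v set \<times> bit"

type_synonym 'v xclause = "'v equation set"

definition xclause :: "'v xclause \<Rightarrow> bool" where
  "xclause C \<longleftrightarrow> finite C \<and> (\<forall>(I, c)\<in>C. finite I)"

definition holds :: "('v \<Rightarrow> bit) \<Rightarrow> 'v equation \<Rightarrow> bool" where
  "holds x q \<longleftrightarrow> (\<Sum>i\<in>fst q. x i) = snd q"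

definition satisfies :: "('v \<Rightarrow> bit) \<Rightarrow> 'v xclause \<Rightarrow> bool" where
  "satisfies x C \<longleftrightarrow> (\<exists>q\<in>C. holds x q)"

definition falsifying :: "'v xclause \<Rightarrow> ('v \<Rightarrow> bit) set" where
  "falsifying C = {x. \<not> satisfies x C}"

definition unsatisfiable :: "'v xclause set \<Rightarrow> bool" where
  "unsatisfiable H \<longleftrightarrow> (\<nexists>x. \<forall>C\<in>H. satisfies x C)"

definition hitting_xor :: "'v xclause set \<Rightarrow> bool" where
  "hitting_xor H \<longleftrightarrow> finite H \<and> (\<forall>C\<in>H. xclause C) \<and>
     pairwise (\<lambda>C D. disjnt (falsifying C) (falsifying D)) H"

fun literal_equation :: "'v literal \<Rightarrow> 'v equation" where
  "literal_equation (Pos v) = ({v}, 1)"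
| "literal_equation (Neg v) = ({v}, 0)"

text \<open>The size of a refutation \<open>H\<close> is \<open>card H\<close>. Its clauses may mention variables that
  do not occur in \<open>F\<close>.\<close>

definition hitting_xor_refutation :: "'v cnf \<Rightarrow> 'v xclause set \<Rightarrow> bool" where
  "hitting_xor_refutation F H \<longleftrightarrow> hitting_xor H \<and> unsatisfiable H \<and>
     (\<forall>C\<in>H. \<exists>C'\<in>F. literal_equation ` C' \<subseteq> C)"

text \<open>A simple graph is a pair of a vertex set and a set of edges, each edge being the
  two-element set of its endpoints. The variable \<open>z\<^sub>e\<close> is the edge \<open>e\<close> itself.\<close>

type_synonym 'a graph = "'a set \<times> 'a set set"

definition incident_edges :: "'a graph \<Rightarrow> 'a \<Rightarrow> 'a set set" where
  "incident_edges G v = {e \<in> snd G. v \<in> e}"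

definition PM :: "'a graph \<Rightarrow> 'a set cnf" where
  "PM G =
     {{Neg f, Neg g} | v f g. v \<in> fst G \<and> f \<in> incident_edges G v \<and> g \<in> incident_edges G v \<and> f \<noteq> g}
   \<union> {Pos ` incident_edges G v | v. v \<in> fst G}"

definition complete_bipartite :: "nat \<Rightarrow> nat \<Rightarrow> (nat + nat) graph" where
  "complete_bipartite a b =
     (Inl ` {..<a} \<union> Inr ` {..<b}, {{Inl i, Inr j} | i j. i < a \<and> j < b})"

end

theory Submission
  imports Defs "HOL-Library.Function_Algebras" "HOL-Combinatorics.Permutations"
begin

text \<open>Consider assignments made of one 3-star centred on the left together with a matching of the remaining
  vertices; the centre is the only violated vertex, so a clause falsified by such an assignment has to name it.
  The matching is split into \<open>T = 10n\<close> blocks on 4 + 4 vertices, each in one of three states. Putting a block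
  into the GF(2)-sum of its three states creates a star on the left and one on the right. A corruption lemma in the
  style of Razborov shows that an affine subspace containing a fraction \<open>\<delta>\<close> of the assignments with all blocks
  matched contains at least a fraction \<open>\<delta> * (1 - O(ln (1 / \<delta>) / T))\<close> of those with one random bad block. It rests
  on the cut-and-paste identity, with the Hellinger distances of letters bounded by the entropy chain rule.
  Now apply this to every clause with the star named by the clause as the original one. An assignment with a
  bad block has two stars on the left that can play this role, so the fractions of these assignments falsifying
  the clauses sum to at least \<open>2 * (1 - O(ln |H| / T))\<close>. As the clauses partition the space they sum
  to 1, whence \<open>ln |H| = \<Omega>(T)\<close>.\<close>

subsection \<open>Words and entropy\<close>

definition words :: "nat \<Rightarrow> nat list set" where
  "words n = {w. set w \<subseteq> {..<3} \<and> length w = n}"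

lemma finite_words [simp]: "finite (words n)"
  unfolding words_def by (rule finite_lists_length_eq) simp

lemma card_words: "card (words n) = 3 ^ n"
  unfolding words_def by (subst card_lists_length_eq) auto

lemma words_0 [simp]: "words 0 = {[]}"
  by (auto simp: words_def)

lemma length_words: "w \<in> words n \<Longrightarrow> length w = n"
  by (simp add: words_def)

lemma sum_words_Cons: "(\<Sum>w\<in>words (Suc n). h w) = (\<Sum>j<3. \<Sum>w\<in>words n. h (j # w))"
proof -
  have "words (Suc n) = (\<lambda>(j, w). j # w) ` ({..<3} \<times> words n)"
    by (auto simp: words_def length_Suc_conv image_iff)
  moreover have "inj_on (\<lambda>(j, w). j # w) ({..<3} \<times> words n)"
    by (auto simp: inj_on_def)
  ultimately show ?thesis
    by (simp add: sum.reindex sum.cartesian_product case_prod_unfold)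
qed

lemma sum_words_rev: "(\<Sum>w\<in>words n. h (rev w)) = (\<Sum>w\<in>words n. h w)"
  by (rule sum.reindex_bij_witness[of _ rev rev]) (auto simp: words_def)

lemma sum_words_snoc: "(\<Sum>w\<in>words (Suc n). h w) = (\<Sum>w\<in>words n. \<Sum>j<3. h (w @ [j]))"
proof -
  have "(\<Sum>w\<in>words (Suc n). h w) = (\<Sum>j<3. \<Sum>w\<in>words n. h (rev (j # w)))"
    using sum_words_rev[of h "Suc n"] sum_words_Cons[of "\<lambda>w. h (rev w)" n] by simp
  also have "\<dots> = (\<Sum>j<3. \<Sum>w\<in>words n. h (w @ [j]))"
    using sum_words_rev[of "\<lambda>w. h (w @ [j])" n for j] by simp
  finally show ?thesis by (simp add: sum.swap[of _ "{..<3}"])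
qed

text \<open>Squared Hellinger distances of the three pairs of letters, without normalisation:
  \<open>c\<close> holds counts instead of probabilities, so the contributions of different prefixes
  simply add up.\<close>

definition hellinger :: "(nat \<Rightarrow> real) \<Rightarrow> real" where
  "hellinger c = (sqrt (c 0) - sqrt (c 1))\<^sup>2 + (sqrt (c 1) - sqrt (c 2))\<^sup>2 + (sqrt (c 2) - sqrt (c 0))\<^sup>2"

lemma sum_lessThan_3: "(\<Sum>j<3. f j) = f 0 + f 1 + f (2::nat)" for f :: "nat \<Rightarrow> 'a::comm_monoid_add"
  by (simp add: eval_nat_numeral add.assoc)

text \<open>This is \<open>ln y \<le> y - 1\<close> at \<open>y = sqrt m / sqrt c\<close>. Summed
  over the letters it says that relative entropy dominates the squared Hellinger distance.\<close>

lemma relative_entropy_ge_sqrt: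
  fixes c m :: real
  assumes "c \<ge> 0" "m > 0"
  shows "2 * c - 2 * (sqrt m * sqrt c) \<le> c * ln c - c * ln m"
proof (cases "c = 0")
  case False
  then have c: "c > 0" using assms by simp
  define y where "y = sqrt m / sqrt c"
  have y: "y > 0" using c assms by (simp add: y_def)
  have "ln y \<le> y - 1" using y by (simp add: ln_le_minus_one)
  moreover have "ln y = (ln m - ln c) / 2"
    using c assms by (simp add: y_def ln_div ln_sqrt diff_divide_distrib)
  ultimately have "c * (ln m - ln c) \<le> c * (2 * (y - 1))"
    using c by (intro mult_left_mono) auto
  moreover have "c * y = sqrt m * sqrt c"
  proof -
    have "c * y = (sqrt c * sqrt c) * (sqrt m / sqrt c)" using c unfolding y_def by simp
    also have "\<dots> = sqrt m * sqrt c" using c by (simp add: field_simps del: real_sqrt_mult_self)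
    finally show ?thesis .
  qed
  ultimately show ?thesis by (simp add: algebra_simps)
qed simp

lemma hellinger_le_entropy:
  assumes "\<And>j. c j \<ge> 0"
  defines "n \<equiv> c 0 + c 1 + c 2"
  shows "hellinger c \<le> 4 * (c 0 * ln (c 0) + c 1 * ln (c 1) + c 2 * ln (c 2) - n * ln n + n * ln 3)"
proof (cases "n = 0")
  case True
  then have "c 0 = 0" "c 1 = 0" "c 2 = 0"
    using assms(1)[of 0] assms(1)[of 1] assms(1)[of 2] by (auto simp: n_def)
  then show ?thesis by (simp add: hellinger_def n_def)
next
  case False
  then have n: "n > 0" using assms(1)[of 0] assms(1)[of 1] assms(1)[of 2] by (simp add: n_def)
  define s where "s = sqrt (n / 3)"
  have sq: "(sqrt (c j))\<^sup>2 = c j" for j using assms(1) by simp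
  have s2: "s\<^sup>2 = n / 3" using n by (simp add: s_def)
  have lnm: "ln (n / 3) = ln n - ln 3" using n by (simp add: ln_div)
  have key: "2 * c j - 2 * (s * sqrt (c j)) \<le> c j * ln (c j) - c j * (ln n - ln 3)" for j
    using relative_entropy_ge_sqrt[of "c j" "n / 3"] assms(1)[of j] n by (simp add: s_def lnm)
  \<comment> \<open>Parallelogram law for each pair: the gap is the sum of the three squares
    supplied to the proof.\<close>
  have tri: "(x - y)\<^sup>2 + (y - z)\<^sup>2 + (z - x)\<^sup>2 \<le> 4 * ((x - s)\<^sup>2 + (y - s)\<^sup>2 + (z - s)\<^sup>2)"
    for x y z :: real
    using zero_le_power2[of "x + y - 2 * s"] zero_le_power2[of "y + z - 2 * s"]
      zero_le_power2[of "z + x - 2 * s"]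
    by (simp add: power2_eq_square algebra_simps)
  have "hellinger c \<le> 4 * ((sqrt (c 0) - s)\<^sup>2 + (sqrt (c 1) - s)\<^sup>2 + (sqrt (c 2) - s)\<^sup>2)"
    unfolding hellinger_def by (rule tri)
  \<comment> \<open>The three terms \<open>s\<^sup>2\<close> add up to \<open>n\<close>, which
    doubles every \<open>c j\<close>.\<close>
  also have "(sqrt (c 0) - s)\<^sup>2 + (sqrt (c 1) - s)\<^sup>2 + (sqrt (c 2) - s)\<^sup>2 =
      (2 * c 0 - 2 * (s * sqrt (c 0))) + (2 * c 1 - 2 * (s * sqrt (c 1))) + (2 * c 2 - 2 * (s * sqrt (c 2)))"
    using sq[of 0] sq[of 1] sq[of 2] s2 by (simp add: power2_diff n_def)
  also have "\<dots> \<le> c 0 * ln (c 0) + c 1 * ln (c 1) + c 2 * ln (c 2) - n * ln n + n * ln 3"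
    using key[of 0] key[of 1] key[of 2] by (simp add: n_def algebra_simps)
  finally show ?thesis by simp
qed

section \<open>Completion counts and the chain rule\<close>

definition completions :: "nat \<Rightarrow> (nat list \<Rightarrow> bool) \<Rightarrow> nat list \<Rightarrow> real" where
  "completions T P x = (\<Sum>y\<in>words (T - length x). of_bool (P (x @ y)))"

lemma completions_split:
  assumes "length x < T"
  shows "completions T P x = (\<Sum>j<3. completions T P (x @ [j]))"
proof -
  obtain k where k: "T - length x = Suc k" using assms by (metis Suc_diff_Suc)
  then have "T - Suc (length x) = k" by simp
  then show ?thesis by (simp add: completions_def k sum_words_Cons)
qed

text \<open>The chain rule for entropy, with the divergence of each letter from uniform bounded below by its
  Hellinger distance; the potential is \<open>\<Sum>x. n x * ln (n x)\<close> over all prefixes \<open>x\<close> of a given length.\<close>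

lemma prefix_energy:
  "(\<Sum>t<T. \<Sum>x\<in>words t. hellinger (\<lambda>j. completions T P (x @ [j])))
     \<le> 4 * (completions T P [] * (real T * ln 3 - ln (completions T P [])))"
proof -
  define n where "n = completions T P"
  define \<Phi> where "\<Phi> t = (\<Sum>x\<in>words t. n x * ln (n x))" for t
  have n0: "n x \<ge> 0" for x by (simp add: n_def completions_def sum_nonneg)
  have mass: "t \<le> T \<Longrightarrow> (\<Sum>x\<in>words t. n x) = n []" for t
  proof (induction t)
    case (Suc t)
    have "(\<Sum>x\<in>words (Suc t). n x) = (\<Sum>x\<in>words t. \<Sum>j<3. n (x @ [j]))"
      by (rule sum_words_snoc)
    also have "\<dots> = (\<Sum>x\<in>words t. n x)"
      using Suc.prems unfolding n_def
      by (intro sum.cong refl completions_split[symmetric]) (auto simp: length_words)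
    finally show ?case using Suc by simp
  qed simp
  have step: "(\<Sum>x\<in>words t. hellinger (\<lambda>j. n (x @ [j]))) \<le> 4 * (\<Phi> (Suc t) - \<Phi> t + n [] * ln 3)"
    if "t < T" for t
  proof -
    have "hellinger (\<lambda>j. n (x @ [j])) \<le>
        4 * ((\<Sum>j<3. n (x @ [j]) * ln (n (x @ [j]))) - n x * ln (n x) + n x * ln 3)"
      if "x \<in> words t" for x
      using hellinger_le_entropy[of "\<lambda>j. n (x @ [j])", OF n0] completions_split[of x T P]
        length_words[OF that] \<open>t < T\<close> by (simp add: n_def sum_lessThan_3)
    then have "(\<Sum>x\<in>words t. hellinger (\<lambda>j. n (x @ [j]))) \<le> (\<Sum>x\<in>words t.
        4 * ((\<Sum>j<3. n (x @ [j]) * ln (n (x @ [j]))) - n x * ln (n x) + n x * ln 3))"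
      by (rule sum_mono)
    also have "\<dots> = 4 * (\<Phi> (Suc t) - \<Phi> t + (\<Sum>x\<in>words t. n x) * ln 3)"
      by (simp add: \<Phi>_def sum_words_snoc sum_distrib_left[symmetric] sum.distrib sum_subtractf
          sum_distrib_right)
    finally show ?thesis using mass that by simp
  qed
  have "(\<Sum>t<T. \<Sum>x\<in>words t. hellinger (\<lambda>j. n (x @ [j]))) \<le>
      (\<Sum>t<T. 4 * (\<Phi> (Suc t) - \<Phi> t + n [] * ln 3))"
    by (rule sum_mono, rule step) simp
  also have "\<dots> = 4 * ((\<Phi> T - \<Phi> 0) + real T * (n [] * ln 3))"
    unfolding sum_distrib_left[symmetric] sum.distrib sum_lessThan_telescope by simp
  \<comment> \<open>A full word has count 0 or 1, and both \<open>0 * ln 0\<close> and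
    \<open>1 * ln 1\<close> vanish.\<close>
  also have "\<Phi> T = 0"
    unfolding \<Phi>_def by (rule sum.neutral) (simp add: n_def completions_def length_words)
  also have "\<Phi> 0 = n [] * ln (n [])"
    by (simp add: \<Phi>_def)
  finally show ?thesis by (simp add: n_def algebra_simps)
qed

definition cocompletions :: "nat \<Rightarrow> (nat list \<Rightarrow> bool) \<Rightarrow> nat list \<Rightarrow> real" where
  "cocompletions T P y = (\<Sum>x\<in>words (T - length y). of_bool (P (x @ y)))"

text \<open>Reversing the words turns suffixes into prefixes, so \<open>prefix_energy\<close>
  applies to the reversed predicate; the sum over \<open>t\<close> then runs backwards.\<close>

lemma suffix_energy:
  "(\<Sum>t<T. \<Sum>y\<in>words (T - Suc t). hellinger (\<lambda>j. cocompletions T P (j # y)))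
     \<le> 4 * (completions T P [] * (real T * ln 3 - ln (completions T P [])))"
proof -
  let ?P = "\<lambda>w. P (rev w)"
  have rev: "completions T ?P x = cocompletions T P (rev x)" for x
    unfolding completions_def cocompletions_def
    by (subst sum_words_rev[symmetric]) simp
  have "completions T ?P [] = completions T P []"
    unfolding completions_def using sum_words_rev[of "\<lambda>w. of_bool (P w) :: real"] by simp
  moreover have "(\<Sum>x\<in>words t. hellinger (\<lambda>j. completions T ?P (x @ [j]))) =
      (\<Sum>y\<in>words t. hellinger (\<lambda>j. cocompletions T P (j # y)))" for t
    by (subst sum_words_rev[symmetric]) (simp add: rev)
  moreover have "(\<Sum>t<T. \<Sum>y\<in>words (T - Suc t). hellinger (\<lambda>j. cocompletions T P (j # y))) =
      (\<Sum>t<T. \<Sum>y\<in>words t. hellinger (\<lambda>j. cocompletions T P (j # y)))"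
    by (rule sum.nat_diff_reindex)
  ultimately show ?thesis using prefix_energy[of T ?P] by simp
qed

text \<open>Written in the square roots, the difference of the two sides is exactly the sum of the
  two squares used in the proof.\<close>

lemma cut_paste_pointwise:
  fixes a a' b b' :: real
  assumes "a \<ge> 0" "a' \<ge> 0" "b \<ge> 0" "b' \<ge> 0"
  shows "a * b' + a' * b - a * b - 2 * (a * (sqrt b - sqrt b')\<^sup>2) - 2 * (b * (sqrt a - sqrt a')\<^sup>2) \<le> a' * b'"
proof -
  have "p\<^sup>2 * q'\<^sup>2 + p'\<^sup>2 * q\<^sup>2 - p\<^sup>2 * q\<^sup>2 - 2 * (p\<^sup>2 * (q - q')\<^sup>2) - 2 * (q\<^sup>2 * (p - p')\<^sup>2) \<le> p'\<^sup>2 * q'\<^sup>2"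
    for p p' q q' :: real
    using zero_le_power2[of "p * q - p' * q'"] zero_le_power2[of "p * (q' - q) - q * (p - p')"]
    by (simp add: power2_eq_square algebra_simps)
  from this[of "sqrt a" "sqrt b'" "sqrt a'" "sqrt b"] show ?thesis using assms by simp
qed

subsection \<open>Cut and paste\<close>

lemma sum_translate:
  fixes U :: "'v::ab_group_add set"
  assumes "\<And>u v. u \<in> U \<Longrightarrow> v \<in> U \<Longrightarrow> u + v \<in> U" and "\<And>u::'v. u + u = 0" and "d \<in> U"
  shows "(\<Sum>u\<in>U. h (u + d)) = sum h U"
  by (rule sum.reindex_bij_witness[of _ "\<lambda>u. u + d" "\<lambda>u. u + d"])
    (use assms in \<open>auto simp: add.assoc\<close>)

text \<open>Sum \<open>cut_paste_pointwise\<close> with \<open>a = p u\<close>,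
  \<open>a' = p (u + d)\<close>, \<open>b = q (u + e\<^sub>0)\<close>,
  \<open>b' = q (u + e\<^sub>1)\<close>. With \<open>d = e\<^sub>0 + e\<^sub>2\<close> and exponent
  2, the four mixed products are translates of the terms of \<open>F\<close> at
  \<open>e\<^sub>0\<close>, \<open>e\<^sub>1\<close>, \<open>e\<^sub>2\<close> and their
  sum.\<close>

lemma cut_paste:
  fixes U :: "'v::ab_group_add set" and p q :: "'v \<Rightarrow> real"
  assumes closed: "\<And>u v. u \<in> U \<Longrightarrow> v \<in> U \<Longrightarrow> u + v \<in> U" and exp2: "\<And>u::'v. u + u = 0"
    and e: "e\<^sub>0 \<in> U" "e\<^sub>1 \<in> U" "e\<^sub>2 \<in> U" and nonneg: "\<And>u. p u \<ge> 0" "\<And>u. q u \<ge> 0"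
  defines "F \<equiv> \<lambda>e. \<Sum>u\<in>U. p u * q (u + e)"
  shows "F e\<^sub>1 + F e\<^sub>2 - F e\<^sub>0 - 2 * (\<Sum>u\<in>U. p u * (sqrt (q (u + e\<^sub>0)) - sqrt (q (u + e\<^sub>1)))\<^sup>2)
      - 2 * (\<Sum>u\<in>U. q u * (sqrt (p (u + e\<^sub>0)) - sqrt (p (u + e\<^sub>2)))\<^sup>2) \<le> F (e\<^sub>0 + e\<^sub>1 + e\<^sub>2)"
proof -
  define d where "d = e\<^sub>0 + e\<^sub>2"
  have d: "d \<in> U" using closed e by (simp add: d_def)
  have cancel: "x + (x + y) = y" for x y :: 'v
    using exp2[of x] by (simp add: add.assoc[symmetric])
  note ac = add.assoc add.commute add.left_commute cancel exp2
  have F: "F e = (\<Sum>u\<in>U. p (u + d) * q (u + (d + e)))" for e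
    unfolding F_def
    using sum_translate[OF closed exp2 d, of "\<lambda>u. p u * q (u + e)"] by (simp add: add.assoc)
  have F2: "F e\<^sub>2 = (\<Sum>u\<in>U. p (u + d) * q (u + e\<^sub>0))"
    by (subst F) (simp add: d_def ac)
  have F3: "F (e\<^sub>0 + e\<^sub>1 + e\<^sub>2) = (\<Sum>u\<in>U. p (u + d) * q (u + e\<^sub>1))"
    by (subst F) (simp add: d_def ac)
  have B: "(\<Sum>u\<in>U. q u * (sqrt (p (u + e\<^sub>0)) - sqrt (p (u + e\<^sub>2)))\<^sup>2) =
      (\<Sum>u\<in>U. q (u + e\<^sub>0) * (sqrt (p u) - sqrt (p (u + d)))\<^sup>2)"
    using sum_translate[OF closed exp2 e(1),
        of "\<lambda>u. q u * (sqrt (p (u + e\<^sub>0)) - sqrt (p (u + e\<^sub>2)))\<^sup>2"]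
    by (simp add: d_def ac)
  have "(\<Sum>u\<in>U. p u * q (u + e\<^sub>1) + p (u + d) * q (u + e\<^sub>0) - p u * q (u + e\<^sub>0)
      - 2 * (p u * (sqrt (q (u + e\<^sub>0)) - sqrt (q (u + e\<^sub>1)))\<^sup>2)
      - 2 * (q (u + e\<^sub>0) * (sqrt (p u) - sqrt (p (u + d)))\<^sup>2)) \<le> (\<Sum>u\<in>U. p (u + d) * q (u + e\<^sub>1))"
    by (intro sum_mono cut_paste_pointwise nonneg)
  then show ?thesis
    unfolding F2 F3 B by (simp add: F_def sum.distrib sum_subtractf sum_distrib_left)
qed

section \<open>Corruption of affine subspaces\<close>

lemma sum_words_append:
  "(\<Sum>w\<in>words (m + n). h w) = (\<Sum>x\<in>words m. \<Sum>y\<in>words n. h (x @ y))"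
  by (induction m arbitrary: h) (simp_all add: sum_words_Cons)

lemma sum_lessThan_add: "(\<Sum>s<m + n. f s) = (\<Sum>s<m. f s) + (\<Sum>s<n. f (m + s))"
  for f :: "nat \<Rightarrow> 'a::comm_monoid_add"
  by (induction n) (simp_all add: add.assoc)

lemma sum_fibres:
  fixes h :: "'v \<Rightarrow> real"
  assumes "finite U" "\<And>x. x \<in> X \<Longrightarrow> \<phi> x \<in> U"
  shows "(\<Sum>u\<in>U. (\<Sum>x\<in>X. of_bool (\<phi> x = u)) * h u) = (\<Sum>x\<in>X. h (\<phi> x))"
proof -
  have "(\<Sum>u\<in>U. of_bool (\<phi> x = u) * h u) = h (\<phi> x)" if "x \<in> X" for x
  proof -
    have "(\<Sum>u\<in>U. of_bool (\<phi> x = u) * h u) = (\<Sum>u\<in>U. if u = \<phi> x then h u else 0)"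
      by (rule sum.cong) auto
    then show ?thesis using assms that by simp
  qed
  then show ?thesis
    by (simp only: sum_distrib_right sum.swap[of _ X]) simp
qed

lemma finite_vanishing_off:
  assumes "finite C"
  shows "finite {v :: 'q \<Rightarrow> bit. \<forall>q. q \<notin> C \<longrightarrow> v q = 0}"
proof -
  have "finite (UNIV :: bit set)"
    by (rule finite_subset[of _ "{0, 1}"]) (auto intro: bit.exhaust)
  then show ?thesis
    using finite_set_of_finite_funs[OF assms, of UNIV 0] by simp
qed

lemma bit_add_eq_0_iff: "a + c = 0 \<longleftrightarrow> a = c" for a c :: bit
  by (cases a; cases c) auto

text \<open>Fix the block \<open>t\<close> and let \<open>u\<close> be the contribution of the blocks before it to the left-hand sides of the
  equations defining \<open>P\<close>. The number of words in \<open>P\<close> with letter \<open>j\<close> at \<open>t\<close> and given \<open>u\<close> is a product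
  \<open>p u * q (u + e j)\<close> with \<open>e 3 = e 0 + e 1 + e 2\<close>, so \<open>cut_paste\<close> applies with each good letter in turn
  in the role of \<open>e\<^sub>0\<close>.\<close>

lemma affine_corruption:
  fixes g :: "nat \<Rightarrow> nat \<Rightarrow> 'q \<Rightarrow> bit"
  assumes C: "finite C" and bad: "\<And>t q. g t 3 q = g t 0 q + g t 1 q + g t 2 q"
    and P: "\<And>w. length w = T \<Longrightarrow> P w \<longleftrightarrow> (\<forall>q\<in>C. b q + (\<Sum>s<T. g s (w ! s) q) = 0)"
  defines "N \<equiv> completions T P []"
  shows "real T * N - 16 * (N * (real T * ln 3 - ln N)) \<le>
    3 * (\<Sum>t<T. \<Sum>x\<in>words t. \<Sum>y\<in>words (T - Suc t). of_bool (P (x @ 3 # y)))"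
proof -
  \<comment> \<open>Vectors of left-hand sides, one entry per equation of \<open>C\<close>; zeroing
    them off \<open>C\<close> makes the group finite, so that sums over it count.\<close>
  define U where "U = {v :: 'q \<Rightarrow> bit. \<forall>q. q \<notin> C \<longrightarrow> v q = 0}"
  define restr where "restr v = (\<lambda>q. if q \<in> C then v q else (0::bit))" for v
  have restr: "restr v \<in> U" for v by (simp add: restr_def U_def)
  have restr_add: "restr u + restr v = restr w \<longleftrightarrow> (\<forall>q\<in>C. u q + v q = w q)" for u v w
    by (auto simp: restr_def fun_eq_iff)
  have finU: "finite U" unfolding U_def by (rule finite_vanishing_off[OF C])
  have closed: "u + v \<in> U" if "u \<in> U" "v \<in> U" for u v
    using that by (auto simp: U_def)
  have exp2: "u + u = 0" for u :: "'q \<Rightarrow> bit"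
    by (rule ext) simp
  have cancel: "u + v + v = u" for u v :: "'q \<Rightarrow> bit"
    by (simp only: add.assoc exp2 add_0_right)
  define f where "f t j = (\<Sum>x\<in>words t. \<Sum>y\<in>words (T - Suc t). of_bool (P (x @ j # y)) :: real)" for t j
  define Ef where "Ef t = (\<Sum>x\<in>words t. hellinger (\<lambda>j. completions T P (x @ [j])))" for t
  define Eb where "Eb t = (\<Sum>y\<in>words (T - Suc t). hellinger (\<lambda>j. cocompletions T P (j # y)))" for t
  have main: "N - 2 * Ef t - 2 * Eb t \<le> 3 * f t 3" if t: "t < T" for t
  proof -
    define k where "k = T - Suc t"
    have T: "T = t + Suc k" using t by (simp add: k_def)
    \<comment> \<open>\<open>\<phi>\<close> collects the constant and the blocks before
      \<open>t\<close>, \<open>\<theta>\<close> the blocks after \<open>t\<close>; as signs do not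
      matter, a word lies in \<open>P\<close> iff
      \<open>\<phi> x + e j = \<theta> y\<close>.\<close>
    define \<phi> where "\<phi> x = restr (\<lambda>q. b q + (\<Sum>s<t. g s (x ! s) q))" for x
    define \<theta> where "\<theta> y = restr (\<lambda>q. \<Sum>s<k. g (t + Suc s) (y ! s) q)" for y
    define e where "e j = restr (g t j)" for j
    have P_iff: "P (x @ j # y) \<longleftrightarrow> \<phi> x + e j = \<theta> y" if "x \<in> words t" "y \<in> words k" for x y j
    proof -
      have "(\<Sum>s<T. g s ((x @ j # y) ! s) q) =
          (\<Sum>s<t. g s (x ! s) q) + (g t j q + (\<Sum>s<k. g (t + Suc s) (y ! s) q))" for q
        unfolding T sum_lessThan_add sum.lessThan_Suc_shift
        using that by (simp add: length_words nth_append)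
      then have "P (x @ j # y) \<longleftrightarrow>
          (\<forall>q\<in>C. (b q + (\<Sum>s<t. g s (x ! s) q) + g t j q) + (\<Sum>s<k. g (t + Suc s) (y ! s) q) = 0)"
        using that T P[of "x @ j # y"] by (simp only: length_words add.assoc length_append list.size add_0_right add_Suc_right)
      also have "\<dots> \<longleftrightarrow>
          (\<forall>q\<in>C. (b q + (\<Sum>s<t. g s (x ! s) q) + g t j q) = (\<Sum>s<k. g (t + Suc s) (y ! s) q))"
        by (simp only: bit_add_eq_0_iff)
      finally show ?thesis by (simp only: \<phi>_def \<theta>_def e_def restr_add)
    qed
    define p where "p u = (\<Sum>x\<in>words t. of_bool (\<phi> x = u) :: real)" for u
    define q where "q u = (\<Sum>y\<in>words k. of_bool (\<theta> y = u) :: real)" for u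
    have q_eq: "q (\<phi> x + e j) = completions T P (x @ [j])" if "x \<in> words t" for x j
    proof -
      have "T - length (x @ [j]) = k" using length_words[OF that] by (simp add: k_def)
      then show ?thesis unfolding q_def completions_def
        by (intro sum.cong) (simp_all add: P_iff[OF that] eq_commute)
    qed
    have p_eq: "p (\<theta> y + e j) = cocompletions T P (j # y)" if "y \<in> words k" for y j
    proof -
      have "T - length (j # y) = t" using length_words[OF that] T by simp
      moreover have "\<phi> x = \<theta> y + e j \<longleftrightarrow> \<phi> x + e j = \<theta> y" for x
        using cancel by metis
      ultimately show ?thesis unfolding p_def cocompletions_def
        by (intro sum.cong) (simp_all add: P_iff[OF _ that])
    qed
    have F: "(\<Sum>u\<in>U. p u * q (u + e j)) = f t j" for j
    proof -
      have "(\<Sum>u\<in>U. p u * q (u + e j)) = (\<Sum>x\<in>words t. q (\<phi> x + e j))"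
        unfolding p_def by (rule sum_fibres[OF finU]) (simp add: \<phi>_def restr)
      also have "\<dots> = f t j"
        unfolding f_def by (intro sum.cong refl, subst q_eq)
          (simp_all add: completions_def length_words)
      finally show ?thesis .
    qed
    \<comment> \<open>Letter \<open>i\<close> plays \<open>e\<^sub>0\<close>. Distances between
      \<open>i\<close> and \<open>j\<close> are measured on completions, those between
      \<open>i\<close> and \<open>l\<close> on cocompletions.\<close>
    have role: "f t j + f t l - f t i
        - 2 * (\<Sum>x\<in>words t. (sqrt (completions T P (x @ [i])) - sqrt (completions T P (x @ [j])))\<^sup>2)
        - 2 * (\<Sum>y\<in>words k. (sqrt (cocompletions T P (i # y)) - sqrt (cocompletions T P (l # y)))\<^sup>2)
        \<le> f t 3" if "e i + e j + e l = e 3" for i j l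
    proof -
      have A: "(\<Sum>u\<in>U. p u * (sqrt (q (u + e i)) - sqrt (q (u + e j)))\<^sup>2) =
          (\<Sum>x\<in>words t. (sqrt (completions T P (x @ [i])) - sqrt (completions T P (x @ [j])))\<^sup>2)"
        unfolding p_def by (subst sum_fibres[OF finU]) (simp_all add: \<phi>_def restr flip: q_eq)
      have B: "(\<Sum>u\<in>U. q u * (sqrt (p (u + e i)) - sqrt (p (u + e l)))\<^sup>2) =
          (\<Sum>y\<in>words k. (sqrt (cocompletions T P (i # y)) - sqrt (cocompletions T P (l # y)))\<^sup>2)"
        unfolding q_def by (subst sum_fibres[OF finU]) (simp_all add: \<theta>_def restr flip: p_eq)
      show ?thesis
        unfolding A[symmetric] B[symmetric] F[symmetric] that[symmetric]
        by (rule cut_paste[OF closed exp2]) (auto simp: e_def restr p_def q_def intro: sum_nonneg)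
    qed
    have e3: "e 3 = e 0 + e 1 + e 2"
      by (rule ext) (simp add: e_def restr_def bad)
    \<comment> \<open>Over the three rotations each good letter counts twice positively and once
      negatively, and each pair of letters occurs once in either direction.\<close>
    have "f t 0 + f t 1 + f t 2 - 2 * Ef t - 2 * Eb t \<le> 3 * f t 3"
      using role[of 0 1 2] role[of 1 2 0] role[of 2 0 1] e3
      by (simp add: Ef_def Eb_def hellinger_def k_def[symmetric] sum.distrib add_ac power2_commute)
    moreover have "N = f t 0 + f t 1 + f t 2"
    proof -
      have "N = (\<Sum>x\<in>words t. \<Sum>j<3. \<Sum>y\<in>words k. of_bool (P (x @ j # y)))"
        unfolding N_def completions_def list.size diff_zero append_Nil T sum_words_append sum_words_Cons ..
      also have "\<dots> = (\<Sum>j<3. f t j)"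
        unfolding f_def k_def[symmetric] by (rule sum.swap)
      finally show ?thesis by (simp add: sum_lessThan_3)
    qed
    ultimately show ?thesis by simp
  qed
  have "real T * N - 2 * (\<Sum>t<T. Ef t) - 2 * (\<Sum>t<T. Eb t) = (\<Sum>t<T. N - 2 * Ef t - 2 * Eb t)"
    by (simp add: sum_subtractf sum_distrib_left)
  also have "\<dots> \<le> (\<Sum>t<T. 3 * f t 3)"
    by (rule sum_mono) (simp add: main)
  finally have "real T * N - 2 * (\<Sum>t<T. Ef t) - 2 * (\<Sum>t<T. Eb t) \<le> 3 * (\<Sum>t<T. f t 3)"
    by (simp add: sum_distrib_left)
  \<comment> \<open>The constant 16 is \<open>2 * 4 + 2 * 4\<close>: factor 2 from
    \<open>cut_paste\<close>, factor 4 from the energy bound, for prefixes and for suffixes.\<close>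
  moreover have "(\<Sum>t<T. Ef t) \<le> 4 * (N * (real T * ln 3 - ln N))"
    unfolding Ef_def N_def by (rule prefix_energy)
  moreover have "(\<Sum>t<T. Eb t) \<le> 4 * (N * (real T * ln 3 - ln N))"
    unfolding Eb_def N_def by (rule suffix_energy)
  ultimately show ?thesis by (simp add: f_def)
qed

subsection \<open>The family of assignments\<close>

text \<open>The left vertices of the graph are the star centres \<open>a\<^sub>k = Inl k\<close> (\<open>k \<le> T\<close>) and
  \<open>c\<^sub>s\<^sub>j = Inl (T + 1 + 3 * s + j)\<close>; the right vertices are \<open>b\<^sub>k\<^sub>j = Inr (3 * k + j)\<close> and
  \<open>d\<^sub>s = Inr (3 * T + 3 + s)\<close>, where \<open>s < T\<close> and \<open>j < 3\<close>. The permutation \<open>\<sigma>\<close> of \<open>{..T}\<close> attaches the star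
  part \<open>k\<close> to block \<open>\<sigma> k\<close>. In state \<open>a < 3\<close>, block \<open>s = \<sigma> k < T\<close> is the perfect matching consisting of
  \<open>a\<^sub>k b\<^sub>k\<^sub>a\<close>, \<open>c\<^sub>s\<^sub>a d\<^sub>s\<close> and \<open>c\<^sub>s\<^sub>j b\<^sub>k\<^sub>j\<close> for \<open>j \<noteq> a\<close>. The sum of these three matchings is state 3, the
  union of the stars with centres \<open>a\<^sub>k\<close> and \<open>d\<^sub>s\<close>. The star part attached to \<open>T\<close> has no block and is always
  in state 3: its centre is the only violated vertex when all blocks are matched.\<close>

definition site :: "nat \<Rightarrow> (nat \<Rightarrow> nat) \<Rightarrow> nat \<Rightarrow> nat" where
  "site T \<sigma> r = (if r < 3 * T + 3 then \<sigma> (r div 3) else r - (3 * T + 3))"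

definition cell :: "nat \<Rightarrow> (nat \<Rightarrow> nat) \<Rightarrow> nat \<Rightarrow> nat \<Rightarrow> nat \<Rightarrow> bit" where
  "cell T \<sigma> l r a =
     of_bool (l = (if r < 3 * T + 3
       then if a = r mod 3 then r div 3 else T + 1 + 3 * \<sigma> (r div 3) + r mod 3
       else T + 1 + 3 * (r - (3 * T + 3)) + a))"

text \<open>State 3 is encoded as the sum, so that hypothesis \<open>bad\<close> of
  \<open>affine_corruption\<close> holds by definition; \<open>state_3_star\<close> recovers the
  star.\<close>

definition state :: "nat \<Rightarrow> (nat \<Rightarrow> nat) \<Rightarrow> nat \<Rightarrow> nat \<Rightarrow> nat \<Rightarrow> bit" where
  "state T \<sigma> l r a = (if a = 3 then cell T \<sigma> l r 0 + cell T \<sigma> l r 1 + cell T \<sigma> l r 2 else cell T \<sigma> l r a)"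

definition letter :: "nat \<Rightarrow> nat list \<Rightarrow> nat \<Rightarrow> nat" where
  "letter T v s = (if s < T then v ! s else 3)"

text \<open>Assignments are total; on variables that are not edges the ends are arbitrary but fixed,
  and the value still depends on at most one letter.\<close>

definition left_end :: "(nat + nat) set \<Rightarrow> nat" where
  "left_end e = (THE l. Inl l \<in> e)"

definition right_end :: "(nat + nat) set \<Rightarrow> nat" where
  "right_end e = (THE r. Inr r \<in> e)"

definition assignment :: "nat \<Rightarrow> (nat \<Rightarrow> nat) \<Rightarrow> nat list \<Rightarrow> (nat + nat) set \<Rightarrow> bit" where
  "assignment T \<sigma> v e =
     state T \<sigma> (left_end e) (right_end e) (letter T v (site T \<sigma> (right_end e)))"

text \<open>Over the three good states a leaf of the star is matched once with its centre and twice
  with the same other vertex, which cancels. The result no longer depends on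
  \<open>\<sigma>\<close>.\<close>

lemma state_3_star: "r < 3 * T + 3 \<Longrightarrow> state T \<sigma> l r 3 = of_bool (l = r div 3)"
proof -
  assume r: "r < 3 * T + 3"
  consider "r mod 3 = 0" | "r mod 3 = 1" | "r mod 3 = 2" by linarith
  then show ?thesis using r by cases (auto simp: state_def cell_def)
qed

text \<open>The star parts attached to \<open>t\<close> and to \<open>T\<close> are both in state 3,
  which forgets \<open>\<sigma>\<close> by \<open>state_3_star\<close>; all other parts keep their
  block.\<close>

lemma assignment_transpose:
  assumes "v ! t = 3"
  shows "assignment T (transpose t T \<circ> \<sigma>) v = assignment T \<sigma> v"
proof
  fix e
  define l r where "l = left_end e" "r = right_end e"
  have "state T (transpose t T \<circ> \<sigma>) l r (letter T v (site T (transpose t T \<circ> \<sigma>) r)) =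
      state T \<sigma> l r (letter T v (site T \<sigma> r))"
  proof (cases "r < 3 * T + 3")
    case True
    show ?thesis
    proof (cases "\<sigma> (r div 3) = t \<or> \<sigma> (r div 3) = T")
      case 1: True
      have "letter T v t = 3" "letter T v T = 3" using assms by (simp_all add: letter_def)
      then have "letter T v (site T (transpose t T \<circ> \<sigma>) r) = 3" "letter T v (site T \<sigma> r) = 3"
        using 1 True by (auto simp: site_def)
      then show ?thesis using True by (simp add: state_3_star)
    qed (simp add: state_def cell_def site_def)
  qed (simp add: state_def cell_def site_def)
  then show "assignment T (transpose t T \<circ> \<sigma>) v e = assignment T \<sigma> v e"
    by (simp add: assignment_def l_r_def)
qed

text \<open>Over GF(2) a negated equation is again an equation, with its constant shifted by 1. This
  is the form required by \<open>affine_corruption\<close>.\<close>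

lemma falsifying_iff: "x \<in> falsifying C \<longleftrightarrow> (\<forall>q\<in>C. (\<Sum>i\<in>fst q. x i) + snd q + 1 = 0)"
proof -
  have "a \<noteq> c \<longleftrightarrow> a + c + 1 = 0" for a c :: bit by (cases a; cases c) auto
  then show ?thesis
    unfolding falsifying_def satisfies_def holds_def mem_Collect_eq bex_simps(8) by metis
qed

lemma clause_corruption:
  fixes T :: nat and \<sigma> :: "nat \<Rightarrow> nat"
  assumes "finite C"
  defines "N \<equiv> completions T (\<lambda>v. assignment T \<sigma> v \<in> falsifying C) []"
  shows "real T * N - 16 * (N * (real T * ln 3 - ln N)) \<le>
    3 * (\<Sum>t<T. \<Sum>x\<in>words t. \<Sum>y\<in>words (T - Suc t). of_bool (assignment T \<sigma> (x @ 3 # y) \<in> falsifying C))"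
proof -
  define st where "st e a = state T \<sigma> (left_end e) (right_end e) a" for e a
  define si where "si e = site T \<sigma> (right_end e)" for e
  \<comment> \<open>An edge depends only on the letter at its site, so every equation splits into
    block contributions \<open>g\<close> and a constant \<open>b\<close>, which also absorbs the
    edges without a block.\<close>
  define g where "g s a q = (\<Sum>e\<in>fst q. if si e = s then st e a else 0)"
    for s a and q :: "(nat + nat) set equation"
  define b where "b q = (\<Sum>e\<in>fst q. if si e < T then 0 else st e 3) + snd q + 1"
    for q :: "(nat + nat) set equation"
  have "g s 3 q = g s 0 q + g s 1 q + g s 2 q" for s q
    unfolding g_def sum.distrib[symmetric] by (rule sum.cong) (auto simp: st_def state_def)
  moreover have "assignment T \<sigma> v \<in> falsifying C \<longleftrightarrow> (\<forall>q\<in>C. b q + (\<Sum>s<T. g s (v ! s) q) = 0)" for v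
  proof -
    have "assignment T \<sigma> v e = (if si e < T then 0 else st e 3) +
        (\<Sum>s<T. if si e = s then st e (v ! s) else 0)" for e
      by (simp add: assignment_def st_def si_def letter_def)
    then have "(\<Sum>e\<in>fst q. assignment T \<sigma> v e) + snd q + 1 = b q + (\<Sum>s<T. g s (v ! s) q)" for q
      unfolding b_def g_def sum.swap[of _ "fst q"] by (simp only: sum.distrib add_ac)
    then show ?thesis by (simp only: falsifying_iff)
  qed
  ultimately show ?thesis
    unfolding N_def using affine_corruption[OF assms(1), of g T "\<lambda>v. assignment T \<sigma> v \<in> falsifying C" b] by blast
qed

section \<open>Vertices satisfied by matched assignments\<close>

lemma left_end_edge [simp]: "left_end {Inl l, Inr r} = l"
  by (simp add: left_end_def)

lemma right_end_edge [simp]: "right_end {Inl l, Inr r} = r"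
  by (simp add: right_end_def)

lemma edge_eq_iff [simp]: "{Inl l, Inr r} = {Inl l', Inr r'} \<longleftrightarrow> l = l' \<and> r = r'"
  by (auto simp: doubleton_eq_iff)

lemma incident_edges_Inl:
  "l < a \<Longrightarrow> incident_edges (complete_bipartite a b) (Inl l) = (\<lambda>r. {Inl l, Inr r}) ` {..<b}"
  by (auto simp: incident_edges_def complete_bipartite_def)

lemma incident_edges_Inr:
  "r < b \<Longrightarrow> incident_edges (complete_bipartite a b) (Inr r) = (\<lambda>l. {Inl l, Inr r}) ` {..<a}"
  by (auto simp: incident_edges_def complete_bipartite_def)

lemma words_nth: "v \<in> words T \<Longrightarrow> s < T \<Longrightarrow> v ! s < 3"
  using nth_mem[of s v] unfolding words_def by blast

lemma assignment_edge:
  assumes "v \<in> words T" "\<sigma> permutes {..T}" "r < 4 * T + 3"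
  shows "assignment T \<sigma> v {Inl l, Inr r} = of_bool (l = (if r < 3 * T + 3
      then if \<sigma> (r div 3) = T \<or> v ! \<sigma> (r div 3) = r mod 3 then r div 3 else T + 1 + 3 * \<sigma> (r div 3) + r mod 3
      else T + 1 + 3 * (r - (3 * T + 3)) + v ! (r - (3 * T + 3))))"
proof -
  have v: "v ! s < 3" if "s < T" for s
    using words_nth[OF assms(1) that] .
  show ?thesis
  proof (cases "r < 3 * T + 3")
    case True
    then have "\<sigma> (r div 3) \<le> T"
      using permutes_in_image[OF assms(2), of "r div 3"] by auto
    then show ?thesis
      using True v[of "\<sigma> (r div 3)"]
      by (auto simp: assignment_def site_def letter_def state_3_star state_def cell_def)
  next
    case False
    then have "r - (3 * T + 3) < T" using assms(3) by simp
    from v[OF this] this show ?thesis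
      using False by (simp add: assignment_def site_def letter_def state_def cell_def)
  qed
qed

text \<open>A right vertex has its single partner by \<open>assignment_edge\<close>. A left centre
  with a block is joined to the leaf chosen by the letter; a vertex \<open>c\<^sub>s\<^sub>j\<close>
  is joined to \<open>d\<^sub>s\<close> if the letter is \<open>j\<close>, and otherwise to the leaf
  \<open>j\<close> of the star attached to \<open>s\<close>.\<close>

lemma unique_edge:
  assumes v: "v \<in> words T" and \<sigma>: "\<sigma> permutes {..T}"
    and u: "u \<in> fst (complete_bipartite (4 * T + 1) (4 * T + 3))"
    and not_special: "\<And>k. u = Inl k \<Longrightarrow> \<sigma> k \<noteq> T"
  shows "\<exists>!e. e \<in> incident_edges (complete_bipartite (4 * T + 1) (4 * T + 3)) u \<and> assignment T \<sigma> v e = 1"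
proof -
  have v3: "v ! s < 3" if "s < T" for s
    using words_nth[OF v that] .
  have \<sigma>_le: "\<sigma> k \<le> T" if "k \<le> T" for k
    using permutes_in_image[OF \<sigma>, of k] that by auto
  note edge = assignment_edge[OF v \<sigma>]
  show ?thesis
  proof (cases u)
    case (Inr r)
    then have r: "r < 4 * T + 3" using u by (auto simp: complete_bipartite_def)
    define l where "l = (if r < 3 * T + 3
      then if \<sigma> (r div 3) = T \<or> v ! \<sigma> (r div 3) = r mod 3 then r div 3 else T + 1 + 3 * \<sigma> (r div 3) + r mod 3
      else T + 1 + 3 * (r - (3 * T + 3)) + v ! (r - (3 * T + 3)))"
    have "l < 4 * T + 1"
    proof (cases "r < 3 * T + 3")
      case True
      then have "r div 3 \<le> T" "r mod 3 < 3" by auto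
      moreover from this have "\<sigma> (r div 3) = T \<or> \<sigma> (r div 3) < T"
        using \<sigma>_le[of "r div 3"] by linarith
      ultimately show ?thesis using True unfolding l_def by (auto simp del: mod_less_divisor)
    next
      case False
      then have "r - (3 * T + 3) < T" using r by simp
      with v3[OF this] show ?thesis using False unfolding l_def if_not_P[OF False] by linarith
    qed
    moreover have "assignment T \<sigma> v {Inl l', Inr r} = 1 \<longleftrightarrow> l' = l" for l'
      unfolding l_def by (simp only: edge[OF r] of_bool_eq_1_iff)
    ultimately show ?thesis
      unfolding Inr incident_edges_Inr[OF r]
      by (intro ex1I[of _ "{Inl l, Inr r}"]) auto
  next
    case (Inl l)
    then have l: "l < 4 * T + 1" using u by (auto simp: complete_bipartite_def)
    have "\<exists>r. r < 4 * T + 3 \<and> assignment T \<sigma> v {Inl l, Inr r} = 1 \<and>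
        (\<forall>r'. r' < 4 * T + 3 \<longrightarrow> assignment T \<sigma> v {Inl l, Inr r'} = 1 \<longrightarrow> r' = r)"
    proof (cases "l \<le> T")
      case True
      have s: "\<sigma> l < T" using \<sigma>_le[OF True] not_special[OF Inl] by simp
      show ?thesis
      proof (intro exI[of _ "3 * l + v ! \<sigma> l"] conjI allI impI)
        show r: "3 * l + v ! \<sigma> l < 4 * T + 3" using True v3[OF s] by simp
        show "assignment T \<sigma> v {Inl l, Inr (3 * l + v ! \<sigma> l)} = 1"
          using True v3[OF s] by (subst edge[OF r]) simp
        fix r' assume r': "r' < 4 * T + 3" and "assignment T \<sigma> v {Inl l, Inr r'} = 1"
        then have "r' div 3 = l \<and> v ! \<sigma> (r' div 3) = r' mod 3"
          using True s by (auto simp: edge[OF r'] split: if_splits)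
        then show "r' = 3 * l + v ! \<sigma> l" using mult_div_mod_eq[of 3 r'] by auto
      qed
    next
      case False
      \<comment> \<open>Beyond the \<open>T + 1\<close> centres, \<open>l\<close> decodes uniquely
        as \<open>c\<^sub>s\<^sub>j\<close>.\<close>
      define s j where "s = (l - (T + 1)) div 3" "j = (l - (T + 1)) mod 3"
      have lsj: "l = T + 1 + 3 * s + j" using False by (simp add: s_j_def)
      have j: "j < 3" by (simp add: s_j_def)
      have s: "s < T" using l lsj by simp
      define k where "k = inv \<sigma> s"
      have k: "\<sigma> k = s" using permutes_inverses(1)[OF \<sigma>] by (simp add: k_def)
      then have kT: "k \<le> T" using permutes_in_image[OF \<sigma>, of k] s by simp
      have k_unique: "\<sigma> k' = s \<Longrightarrow> k' = k" for k'
        using k permutes_inj[OF \<sigma>] by (auto dest: injD)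
      have eq: "T + 1 + 3 * s + j = T + 1 + 3 * s' + j' \<longleftrightarrow> s' = s \<and> j' = j" if "j' < 3" for s' j'
    proof -
      have "(3 * s + j) div 3 = s" "(3 * s' + j') div 3 = s'" using j that by simp_all
      then show ?thesis by (metis add.assoc add_left_cancel)
    qed
      have star: "\<sigma> (r' div 3) = s \<and> r' mod 3 = j \<and> v ! s \<noteq> j"
        if r': "r' < 3 * T + 3" and 1: "assignment T \<sigma> v {Inl l, Inr r'} = 1" for r'
      proof -
        have "r' < 4 * T + 3" using r' by simp
        then have l_if: "l = (if \<sigma> (r' div 3) = T \<or> v ! \<sigma> (r' div 3) = r' mod 3
            then r' div 3 else T + 1 + 3 * \<sigma> (r' div 3) + r' mod 3)"
          using 1 r' by (simp only: edge of_bool_eq_1_iff if_True)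
        have no: "\<not> (\<sigma> (r' div 3) = T \<or> v ! \<sigma> (r' div 3) = r' mod 3)"
        proof
          assume "\<sigma> (r' div 3) = T \<or> v ! \<sigma> (r' div 3) = r' mod 3"
          then have "l = r' div 3" using l_if by (simp only: if_P)
          then show False using False r' by auto
        qed
        have "l = T + 1 + 3 * \<sigma> (r' div 3) + r' mod 3"
          using l_if unfolding if_not_P[OF no] .
        from iffD1[OF eq trans[OF lsj[symmetric] this]]
        have "\<sigma> (r' div 3) = s" "r' mod 3 = j" by simp_all
        moreover from this no have "v ! s \<noteq> j" by simp
        ultimately show ?thesis by simp
      qed
      have centre: "r' = 3 * T + 3 + s \<and> v ! s = j"
        if r': "\<not> r' < 3 * T + 3" "r' < 4 * T + 3" and 1: "assignment T \<sigma> v {Inl l, Inr r'} = 1" for r'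
      proof -
        have lt: "r' - (3 * T + 3) < T" using r' by simp
        have "l = T + 1 + 3 * (r' - (3 * T + 3)) + v ! (r' - (3 * T + 3))"
          using 1 by (simp only: edge[OF r'(2)] of_bool_eq_1_iff if_not_P[OF r'(1)])
        from iffD1[OF eq[OF v3[OF lt]] trans[OF lsj[symmetric] this]]
        have "r' - (3 * T + 3) = s \<and> v ! (r' - (3 * T + 3)) = j" .
        then show ?thesis using r' by auto
      qed
      show ?thesis
      proof (cases "v ! s = j")
        case True
        show ?thesis
        proof (intro exI[of _ "3 * T + 3 + s"] conjI allI impI)
          show r: "3 * T + 3 + s < 4 * T + 3" using s by simp
          show "assignment T \<sigma> v {Inl l, Inr (3 * T + 3 + s)} = 1"
            using True lsj by (subst edge[OF r]) simp
          show "r' = 3 * T + 3 + s"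
            if "r' < 4 * T + 3" "assignment T \<sigma> v {Inl l, Inr r'} = 1" for r'
            using star[of r'] centre[of r'] that True by blast
        qed
      next
        case vs: False
        show ?thesis
        proof (intro exI[of _ "3 * k + j"] conjI allI impI)
          show r: "3 * k + j < 4 * T + 3" using kT j by simp
          show "assignment T \<sigma> v {Inl l, Inr (3 * k + j)} = 1"
            using vs lsj kT j k s by (subst edge[OF r]) simp
          fix r' assume r': "r' < 4 * T + 3" and 1: "assignment T \<sigma> v {Inl l, Inr r'} = 1"
          then have "\<sigma> (r' div 3) = s" "r' mod 3 = j"
            using star[of r'] centre[of r'] vs by blast+
          then show "r' = 3 * k + j"
            using k_unique[of "r' div 3"] mult_div_mod_eq[of 3 r'] by simp
        qed
      qed
    qed
    then obtain r where r: "r < 4 * T + 3" "assignment T \<sigma> v {Inl l, Inr r} = 1"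
      and unique: "\<And>r'. r' < 4 * T + 3 \<Longrightarrow> assignment T \<sigma> v {Inl l, Inr r'} = 1 \<Longrightarrow> r' = r"
      by (elim exE conjE) (rule that, assumption+, elim allE impE, assumption+)
    show ?thesis
      unfolding Inl incident_edges_Inl[OF l]
    proof (rule ex1I)
      show "{Inl l, Inr r} \<in> (\<lambda>r. {Inl l, Inr r}) ` {..<4 * T + 3} \<and> assignment T \<sigma> v {Inl l, Inr r} = 1"
        using r by (intro conjI imageI) simp_all
      fix e
      assume e: "e \<in> (\<lambda>r. {Inl l, Inr r}) ` {..<4 * T + 3} \<and> assignment T \<sigma> v e = 1"
      then obtain r' where "r' < 4 * T + 3" "e = {Inl l, Inr r'}" by (elim conjE imageE) simp
      with e unique[of r'] show "e = {Inl l, Inr r}" by (simp only: simp_thms)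
    qed
  qed
qed

text \<open>\<open>u\<close> is the vertex whose axiom is \<open>C'\<close>. It is chosen before
  \<open>\<sigma>\<close> and \<open>v\<close>, so a clause admits at most one special
  centre.\<close>

lemma violated_vertex:
  assumes "C' \<in> PM (complete_bipartite (4 * T + 1) (4 * T + 3))"
  obtains u :: "nat + nat" where "\<And>\<sigma> v. v \<in> words T \<Longrightarrow> \<sigma> permutes {..T} \<Longrightarrow>
    assignment T \<sigma> v \<in> falsifying (literal_equation ` C') \<Longrightarrow> \<exists>k. u = Inl k \<and> \<sigma> k = T"
proof -
  let ?G = "complete_bipartite (4 * T + 1) (4 * T + 3)"
  have "\<exists>u \<in> fst ?G. C' = Pos ` incident_edges ?G u \<or>
      (\<exists>f g. C' = {Neg f, Neg g} \<and> f \<in> incident_edges ?G u \<and> g \<in> incident_edges ?G u \<and> f \<noteq> g)"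
    using assms unfolding PM_def by blast
  then obtain u where u: "u \<in> fst ?G" and C': "C' = Pos ` incident_edges ?G u \<or>
      (\<exists>f g. C' = {Neg f, Neg g} \<and> f \<in> incident_edges ?G u \<and> g \<in> incident_edges ?G u \<and> f \<noteq> g)"
    by blast
  show ?thesis
  proof (rule that[of u], rule ccontr)
    fix \<sigma> v
    assume v: "v \<in> words T" and \<sigma>: "\<sigma> permutes {..T}"
      and x: "assignment T \<sigma> v \<in> falsifying (literal_equation ` C')"
      and no: "\<nexists>k. u = Inl k \<and> \<sigma> k = T"
    have "\<exists>!e. e \<in> incident_edges ?G u \<and> assignment T \<sigma> v e = 1"
      using unique_edge[OF v \<sigma> u] no by blast
    moreover have "x = 1" if "x \<noteq> 0" for x :: bit
      using that by (cases x) auto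
    moreover have "(\<forall>e\<in>incident_edges ?G u. assignment T \<sigma> v e \<noteq> 1) \<or>
        (\<exists>f\<in>incident_edges ?G u. \<exists>g\<in>incident_edges ?G u. f \<noteq> g \<and>
          assignment T \<sigma> v f \<noteq> 0 \<and> assignment T \<sigma> v g \<noteq> 0)"
      using C'
    proof
      assume "C' = Pos ` incident_edges ?G u"
      then show ?thesis using x by (simp add: falsifying_def satisfies_def holds_def)
    next
      assume "\<exists>f g. C' = {Neg f, Neg g} \<and> f \<in> incident_edges ?G u \<and> g \<in> incident_edges ?G u \<and> f \<noteq> g"
      then obtain f g where "C' = {Neg f, Neg g}" "f \<in> incident_edges ?G u" "g \<in> incident_edges ?G u" "f \<noteq> g"
        by blast
      moreover from this(1) have "assignment T \<sigma> v f \<noteq> 0" "assignment T \<sigma> v g \<noteq> 0"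
        using x by (simp_all add: falsifying_def satisfies_def holds_def)
      ultimately show ?thesis by blast
    qed
    ultimately show False by blast
  qed
qed

subsection \<open>Counting over a refutation\<close>

lemma sum_falsifying:
  assumes "hitting_xor_refutation F H"
  shows "(\<Sum>C\<in>H. of_bool (x \<in> falsifying C)) = (1 :: real)"
proof -
  have fin: "finite H" and dis: "pairwise (\<lambda>C D. disjnt (falsifying C) (falsifying D)) H"
    and "unsatisfiable H"
    using assms by (auto simp: hitting_xor_refutation_def hitting_xor_def)
  then obtain D where D: "D \<in> H" "x \<in> falsifying D"
    unfolding unsatisfiable_def falsifying_def by blast
  have "x \<in> falsifying C \<longleftrightarrow> C = D" if "C \<in> H" for C
    using D that pairwiseD[OF dis, of C D] unfolding disjnt_iff by blast
  then have "(\<Sum>C\<in>H. of_bool (x \<in> falsifying C)) = (\<Sum>C\<in>H. if C = D then 1 else (0::real))"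
    by (intro sum.cong) simp_all
  then show ?thesis using fin D by simp
qed

text \<open>Gibbs' inequality: the entropy of the distribution \<open>N C / M\<close> on
  \<open>H\<close> is at most that of the uniform one, by \<open>ln y \<le> y - 1\<close> at
  \<open>y = M / (h * N C)\<close>.\<close>

lemma entropy_le_ln_card:
  fixes N :: "'c \<Rightarrow> real"
  assumes "finite H" "H \<noteq> {}" "M > 0" "\<And>C. N C \<ge> 0" "(\<Sum>C\<in>H. N C) = M"
  shows "(\<Sum>C\<in>H. N C * (ln M - ln (N C))) \<le> M * ln (card H)"
proof -
  define h where "h = real (card H)"
  have h: "h > 0" using assms by (simp add: h_def card_gt_0_iff)
  have "N C * (ln M - ln (N C)) \<le> M / h - N C + N C * ln h" for C
  proof (cases "N C = 0")
    case True
    then show ?thesis using h assms(3) by simp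
  next
    case False
    then have N: "N C > 0" using assms(4)[of C] by simp
    have "ln (M / (h * N C)) \<le> M / (h * N C) - 1"
      using N h assms(3) by (intro ln_le_minus_one) simp
    then have "N C * (ln M - ln h - ln (N C)) \<le> N C * (M / (h * N C) - 1)"
      using N h assms(3) by (intro mult_left_mono) (simp_all add: ln_div ln_mult)
    also have "\<dots> = M / h - N C" using N h by (simp add: field_simps)
    finally show ?thesis by (simp add: algebra_simps)
  qed
  then have "(\<Sum>C\<in>H. N C * (ln M - ln (N C))) \<le> (\<Sum>C\<in>H. M / h - N C + N C * ln h)"
    by (rule sum_mono)
  also have "\<dots> = h * (M / h) - M + M * ln h"
    using assms(5) by (simp add: sum.distrib sum_subtractf h_def sum_distrib_right[symmetric])
  also have "\<dots> = M * ln h" using h by simp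
  finally show ?thesis by (simp add: h_def)
qed

text \<open>This is where the contradiction comes from: if block \<open>t\<close> is in state 3, its star is
  indistinguishable from the special one, so fixing which star is special loses a factor of 2.\<close>

lemma sum_special_le_sum:
  fixes b :: "(nat \<Rightarrow> nat) \<Rightarrow> real"
  assumes "t < T" "\<And>\<sigma>. b \<sigma> \<ge> 0" "\<And>\<sigma>. b (transpose t T \<circ> \<sigma>) = b \<sigma>"
  shows "2 * (\<Sum>\<sigma> | \<sigma> permutes {..T} \<and> \<sigma> k = T. b \<sigma>) \<le> (\<Sum>\<sigma> | \<sigma> permutes {..T}. b \<sigma>)"
proof -
  let ?S = "\<lambda>s. {\<sigma>. \<sigma> permutes {..T} \<and> \<sigma> k = s}"
  have perm: "transpose t T \<circ> \<sigma> permutes {..T}" if "\<sigma> permutes {..T}" for \<sigma>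
    using that assms(1) by (intro permutes_compose permutes_swap_id) auto
  have invol: "transpose t T \<circ> (transpose t T \<circ> \<sigma>) = \<sigma>" for \<sigma> :: "nat \<Rightarrow> nat"
    by (simp add: comp_assoc[symmetric])
  have fin: "finite (?S s)" for s
    by (rule finite_subset[OF _ finite_permutations[of "{..T}"]]) auto
  \<comment> \<open>Exchanging the values \<open>t\<close> and \<open>T\<close> maps the
    permutations with \<open>\<sigma> k = T\<close> onto those with \<open>\<sigma> k = t\<close>, a
    disjoint set since \<open>t < T\<close>.\<close>
  have "(\<Sum>\<sigma>\<in>?S T. b \<sigma>) = (\<Sum>\<sigma>\<in>?S t. b \<sigma>)"
    by (rule sum.reindex_bij_witness[of _ "\<lambda>\<sigma>. transpose t T \<circ> \<sigma>" "\<lambda>\<sigma>. transpose t T \<circ> \<sigma>"])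
      (auto simp: perm invol assms(3) simp del: comp_apply, auto)
  then have "2 * (\<Sum>\<sigma>\<in>?S T. b \<sigma>) = (\<Sum>\<sigma>\<in>?S T \<union> ?S t. b \<sigma>)"
    using assms(1) by (subst sum.union_disjoint) (auto simp: fin)
  also have "\<dots> \<le> (\<Sum>\<sigma> | \<sigma> permutes {..T}. b \<sigma>)"
    by (rule sum_mono2) (auto simp: finite_permutations assms(2))
  finally show ?thesis .
qed

text \<open>The sum of \<open>L \<sigma> C\<close> over all \<open>\<sigma>\<close> and
  \<open>C\<close> is bounded from below by entropy and from above by corruption with the gained
  factor 2.\<close>

lemma refutation_size:
  assumes H: "hitting_xor_refutation (PM (complete_bipartite (4 * T + 1) (4 * T + 3))) H"
  shows "real T \<le> 32 * ln (card H)"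
proof -
  define \<SS> where "\<SS> = {\<sigma>. \<sigma> permutes {..T}}"
  define N where "N \<sigma> C = completions T (\<lambda>v. assignment T \<sigma> v \<in> falsifying C) []" for \<sigma> C
  define B where "B \<sigma> C t = (\<Sum>x\<in>words t. \<Sum>y\<in>words (T - Suc t).
    of_bool (assignment T \<sigma> (x @ 3 # y) \<in> falsifying C) :: real)" for \<sigma> C t
  define L where "L \<sigma> C = real T * N \<sigma> C - 16 * (N \<sigma> C * (real T * ln 3 - ln (N \<sigma> C)))" for \<sigma> C
  define M where "M = (3::real) ^ T"
  have finH: "finite H" using H by (simp add: hitting_xor_refutation_def hitting_xor_def)
  have finS: "finite \<SS>" by (simp add: \<SS>_def finite_permutations)
  have "id \<in> \<SS>" by (simp add: \<SS>_def permutes_id)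
  then have cardS: "card \<SS> > 0" using finS by (auto simp only: card_gt_0_iff)
  have H_ne: "H \<noteq> {}"
    using H by (auto simp: hitting_xor_refutation_def unsatisfiable_def)
  have N_nonneg: "N \<sigma> C \<ge> 0" for \<sigma> C by (simp add: N_def completions_def sum_nonneg)
  have N_sum: "(\<Sum>C\<in>H. N \<sigma> C) = M" for \<sigma>
    unfolding N_def completions_def append_Nil
    by (subst sum.swap) (simp only: sum_falsifying[OF H], simp add: card_words M_def)
  \<comment> \<open>The letter at \<open>t\<close> is fixed, leaving \<open>T - 1\<close> free
    ones.\<close>
  have B_sum: "(\<Sum>C\<in>H. B \<sigma> C t) = M / 3" if "t < T" for \<sigma> t
  proof -
    have "(\<Sum>C\<in>H. B \<sigma> C t) = (\<Sum>x\<in>words t. \<Sum>y\<in>words (T - Suc t). 1)"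
      unfolding B_def sum.swap[of _ _ H] sum_falsifying[OF H] ..
    also have "\<dots> = 3 ^ (t + (T - Suc t))" by (simp add: card_words power_add)
    also have "\<dots> = M / 3"
    proof -
      have "T = Suc (t + (T - Suc t))" using that by simp
      then have "M = 3 * 3 ^ (t + (T - Suc t))" unfolding M_def by (metis power_Suc)
      then show ?thesis by simp
    qed
    finally show ?thesis .
  qed
  have B_nonneg: "B \<sigma> C t \<ge> 0" for \<sigma> C t by (simp add: B_def sum_nonneg)
  have B_swap: "B (transpose t T \<circ> \<sigma>) C t = B \<sigma> C t" for \<sigma> C t
    unfolding B_def by (intro sum.cong refl, subst assignment_transpose)
      (auto dest: length_words simp: nth_append)
  have L_le: "L \<sigma> C \<le> 3 * (\<Sum>t<T. B \<sigma> C t)" if "C \<in> H" for \<sigma> C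
  proof -
    have "finite C" using H that by (auto simp: hitting_xor_refutation_def hitting_xor_def xclause_def)
    from clause_corruption[OF this] show ?thesis by (simp add: L_def N_def B_def)
  qed
  have clause: "2 * (\<Sum>\<sigma>\<in>\<SS>. L \<sigma> C) \<le> 3 * (\<Sum>t<T. \<Sum>\<sigma>\<in>\<SS>. B \<sigma> C t)" if C: "C \<in> H" for C
  proof -
    obtain C' where C': "C' \<in> PM (complete_bipartite (4 * T + 1) (4 * T + 3))" "literal_equation ` C' \<subseteq> C"
      using H C by (auto simp: hitting_xor_refutation_def)
    obtain u :: "nat + nat" where u: "\<And>\<sigma> v. v \<in> words T \<Longrightarrow> \<sigma> permutes {..T} \<Longrightarrow>
        assignment T \<sigma> v \<in> falsifying (literal_equation ` C') \<Longrightarrow> \<exists>k. u = Inl k \<and> \<sigma> k = T"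
      using violated_vertex[OF C'(1)] by blast
    \<comment> \<open>If \<open>u\<close> is a right vertex, \<open>k\<close> is arbitrary; then no
      matched assignment falsifies \<open>C\<close> and every \<open>L \<sigma> C\<close>
      vanishes.\<close>
    define k where "k = projl u"
    let ?S = "{\<sigma>. \<sigma> permutes {..T} \<and> \<sigma> k = T}"
    have L0: "L \<sigma> C = 0" if "\<sigma> \<in> \<SS> - ?S" for \<sigma>
    proof -
      have "assignment T \<sigma> v \<notin> falsifying C" if v: "v \<in> words T" for v
      proof
        assume "assignment T \<sigma> v \<in> falsifying C"
        then have "assignment T \<sigma> v \<in> falsifying (literal_equation ` C')"
          using C'(2) by (auto simp: falsifying_def satisfies_def)
        moreover have "\<sigma> permutes {..T}" using \<open>\<sigma> \<in> \<SS> - ?S\<close> by (simp add: \<SS>_def)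
        ultimately obtain k' where "u = Inl k'" "\<sigma> k' = T" using u[OF v] by blast
        then show False using \<open>\<sigma> \<in> \<SS> - ?S\<close> by (simp add: \<SS>_def k_def)
      qed
      then have "N \<sigma> C = 0" by (simp add: N_def completions_def)
      then show ?thesis by (simp add: L_def)
    qed
    have "(\<Sum>\<sigma>\<in>\<SS>. L \<sigma> C) = (\<Sum>\<sigma>\<in>?S. L \<sigma> C)"
      by (rule sum.mono_neutral_right[OF finS]) (use L0 in \<open>auto simp: \<SS>_def\<close>)
    also have "\<dots> \<le> (\<Sum>\<sigma>\<in>?S. 3 * (\<Sum>t<T. B \<sigma> C t))"
      by (rule sum_mono) (rule L_le[OF C])
    also have "\<dots> = 3 * (\<Sum>t<T. \<Sum>\<sigma>\<in>?S. B \<sigma> C t)"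
      unfolding sum_distrib_left[symmetric] sum.swap[of _ "{..<T}"] ..
    finally have "2 * (\<Sum>\<sigma>\<in>\<SS>. L \<sigma> C) \<le> 3 * (\<Sum>t<T. 2 * (\<Sum>\<sigma>\<in>?S. B \<sigma> C t))"
      unfolding sum_distrib_left[symmetric] by simp
    also have "\<dots> \<le> 3 * (\<Sum>t<T. \<Sum>\<sigma>\<in>\<SS>. B \<sigma> C t)"
      unfolding \<SS>_def by (intro mult_left_mono sum_mono sum_special_le_sum) (auto simp: B_nonneg B_swap)
    finally show ?thesis .
  qed
  have "(\<Sum>C\<in>H. L \<sigma> C) \<ge> real T * M - 16 * (M * ln (card H))" for \<sigma>
  proof -
    \<comment> \<open>Here \<open>ln M = real T * ln 3\<close>, so the loss terms add up to an
      entropy.\<close>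
    have "(\<Sum>C\<in>H. L \<sigma> C) = real T * M - 16 * (\<Sum>C\<in>H. N \<sigma> C * (ln M - ln (N \<sigma> C)))"
      unfolding L_def N_sum[of \<sigma>, symmetric] sum_subtractf sum_distrib_left
      by (simp add: N_sum M_def ln_realpow)
    moreover have "(\<Sum>C\<in>H. N \<sigma> C * (ln M - ln (N \<sigma> C))) \<le> M * ln (card H)"
      by (rule entropy_le_ln_card[OF finH H_ne _ N_nonneg N_sum]) (simp add: M_def)
    ultimately show ?thesis by simp
  qed
  then have "(\<Sum>\<sigma>\<in>\<SS>. real T * M - 16 * (M * ln (card H))) \<le> (\<Sum>\<sigma>\<in>\<SS>. \<Sum>C\<in>H. L \<sigma> C)"
    by (rule sum_mono)
  then have "2 * (card \<SS> * (real T * M - 16 * (M * ln (card H)))) \<le> (\<Sum>C\<in>H. 2 * (\<Sum>\<sigma>\<in>\<SS>. L \<sigma> C))"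
    unfolding sum_distrib_left[symmetric] sum.swap[of _ \<SS>] sum_constant by simp
  also have "\<dots> \<le> (\<Sum>C\<in>H. 3 * (\<Sum>t<T. \<Sum>\<sigma>\<in>\<SS>. B \<sigma> C t))"
    by (rule sum_mono) (rule clause)
  also have "\<dots> = 3 * (\<Sum>t<T. \<Sum>\<sigma>\<in>\<SS>. \<Sum>C\<in>H. B \<sigma> C t)"
    unfolding sum_distrib_left[symmetric] sum.swap[of _ _ H] ..
  also have "\<dots> = card \<SS> * (real T * M)"
    by (simp add: B_sum)
  \<comment> \<open>Cancelling \<open>M\<close> leaves
    \<open>T \<le> 2 * 16 * ln (card H)\<close>.\<close>
  finally have "2 * (real T * M - 16 * (M * ln (card H))) \<le> real T * M"
    using cardS by simp
  then have "M * real T \<le> M * (32 * ln (card H))" by (simp add: algebra_simps)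
  then show ?thesis by (simp add: M_def)
qed

theorem theorem6p8:
  "\<exists>c::real. c > 0 \<and>
     (\<forall>n::nat. n \<ge> 1 \<longrightarrow>
       (\<forall>H. hitting_xor_refutation (PM (complete_bipartite (40 * n + 1) (40 * n + 3))) H \<longrightarrow>
          real (card H) \<ge> 2 powr (c * real n)))"
\<comment> \<open>With \<open>T = 10 * n\<close> the graph has the required parts, and
  \<open>10 / 32 = 5 / 16\<close>; passing from base \<open>e\<close> to base 2 only weakens the
  bound.\<close>
proof (intro exI[of _ "5 / 16"] conjI allI impI)
  fix n :: nat and H
  assume "n \<ge> 1" and H: "hitting_xor_refutation (PM (complete_bipartite (40 * n + 1) (40 * n + 3))) H"
  then have "real (10 * n) \<le> 32 * ln (card H)"
    by (intro refutation_size) simp_all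
  then have ln: "5 / 16 * real n \<le> ln (card H)" by simp
  then have "card H \<noteq> 0" using \<open>n \<ge> 1\<close> by (intro notI) simp
  have "ln 2 \<le> (1::real)" using ln_le_minus_one[of "2::real"] by simp
  then have "2 powr (5 / 16 * real n) \<le> exp (5 / 16 * real n)"
    by (simp add: powr_def mult_left_le)
  also have "\<dots> \<le> exp (ln (card H))" using ln by simp
  also have "\<dots> = card H" using \<open>card H \<noteq> 0\<close> by simp
  finally show "2 powr (5 / 16 * real n) \<le> real (card H)" .
qed simp

end
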